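(* Consider a binary-input finite-state intersymbol interference channel with additive white Gaussian noise of mean $0$ and variance $\sigma^2>0$ per output, used for $N$ time steps with the joint LP decoder. Let $\mathbf c$ be a symbol-wise signal-space codeword (SSCW) and $\mathbf p\ne\mathbf c$ a joint-decoding symbol-wise signal-space pseudo-codeword (JD-SSPCW) with trellis-wise description $\mathbf g$. Then the pairwise error probability between $\mathbf c$ and $\mathbf p$ is $$\Pr(\mathbf c\to\mathbf p)=Q\!\left(\frac{d_{gen}(\mathbf c,\mathbf p)}{2\sigma}\right),\qquad Q(x)=\frac1{\sqrt{2\pi}}\int_x^\infty e^{-t^2/2}\,dt .$$
   Context: Trellis: one section has edge set $E=\{1,\dots,O\}$; an edge $e$ has initial state $s(e)$, final state $s'(e)$ (in a finite set $\mathcal S$), input bit $x(e)\in\{0,1\}$ and real noiseless output $a(e)$. $\mathcal T_i$ is the copy of the edge set at time $i\in\mathcal I=\{1,\dots,N\}$. The trellis polytope $\mathcal T$ is the set of $\mathbf g\in[0,1]^{N\times O}$ with $\sum_{e:s'(e)=k}g_{i,e}=\sum_{e:s(e)=k}g_{i+1,e}$ for $1\le i\le N-1$, $k\in\mathcal S$, and $\sum_{e\in\mathcal T_p}g_{p,e}=1$ for any $p\in\mathcal I$. For a parity-check matrix $H$ with row supports $\mathcal L$, $\mathcal P(H)=\bigcap_{L\in\mathcal L}\bigcap_{S\subseteq L,|S|\text{ odd}}\{\mathbf f\in[0,1]^N:\sum_{i\in S}f_i-\sum_{i\in L\setminus S}f_i\le|S|-1\}$, and $\mathcal P_{\mathcal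 T}(H)$ is the set of $\mathbf g\in\mathcal T$ such that the vector $(f_i)_i$ with $f_i=\sum_{e\in\mathcal T_i:x(e)=1}g_{i,e}$ lies in $\mathcal P(H)$. For AWGN the joint LP decoder minimizes $\sum_{i}\sum_{e\in\mathcal T_i}(y_i-a(e))^2g_{i,e}$ over $\mathbf g\in\mathcal P_{\mathcal T}(H)$. A possible decoder output $\mathbf g\in\mathcal P_{\mathcal T}(H)$ is a trellis-wise codeword if all $g_{i,e}\in\{0,1\}$, and a joint-decoding trellis-wise pseudo-codeword if it is nonintegral. The vector $\mathbf p=(p_1,\dots,p_N)$, $p_i=\sum_{e\in\mathcal T_i}g_{i,e}a(e)$, is called an SSCW in the first case and a JD-SSPCW in the second. When $\mathbf c$ is transmitted, the received sequence is $\mathbf y=\mathbf c+\mathbf v$ with $\mathbf v$ i.i.d. Gaussian of mean $0$ and variance $\sigma^2$. $\Pr(\mathbf c\to\mathbf p)$ is the probability that the decoder prefers $\mathbf p$ (described by $\mathbf g$) over $\mathbf c$, i.e. that $\sum_{i}\sum_{e\in\mathcal T_i}g_{i,e}(y_i-a(e))^2\le\sum_i(y_i-c_i)^2$. Generalized Euclidean distance: $d_{gen}(\mathbf c,\mathbf p)$ is the nonnegative square root of $$d_{gen}^2(\mathbf c,\mathbf p)=\frac{(\|\mathbf d\|^2+\sigma_p^2)^2}{\|\mathbf d\|^2},\quad \|\mathbf d\|^2=\sum_{i\in\mathcal I}(c_i-p_i)^2,\quad \sigma_p^2=\sum_{i\in\mathcal I}\sum_{e\in\mathcal T_i}g_{i,e}a(e)^2-\sum_{i\in\mathcal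 I}p_i^2 .$$ *)

theory Defs
  imports "HOL-Probability.Probability" "HOL-Library.Z2"
begin

text \<open>
  One trellis section. Edges are numbered 1, ..., \<open>num_edges\<close>; the field values at other
  arguments are irrelevant. Input bits live in the two-element field \<^typ>\<open>bit\<close>.
\<close>

record 's trellis =
  states :: "'s set"
  num_edges :: nat
  edge_init :: "nat \<Rightarrow> 's"
  edge_final :: "nat \<Rightarrow> 's"
  edge_input :: "nat \<Rightarrow> bit"
  edge_output :: "nat \<Rightarrow> real"

definition edges :: "'s trellis \<Rightarrow> nat set" where
  "edges T = {1..num_edges T}"

definition finite_state_trellis :: "'s trellis \<Rightarrow> bool" where
  "finite_state_trellis T \<longleftrightarrow>
     finite (states T) \<and> edge_init T ` edges T \<subseteq> states T \<and> edge_final T ` edges T \<subseteq> states T"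

text \<open>
  A point of \<open>[0,1]\<close> to the power \<open>N \<times> O\<close> is a function \<open>g\<close> with entries \<open>g i e\<close>,
  \<open>1 \<le> i \<le> N\<close>, \<open>e \<in> edges T\<close>; entries outside this range are unconstrained and never used.
\<close>

definition trellis_polytope :: "'s trellis \<Rightarrow> nat \<Rightarrow> (nat \<Rightarrow> nat \<Rightarrow> real) set" where
  "trellis_polytope T N = {g.
     (\<forall>i\<in>{1..N}. \<forall>e\<in>edges T. 0 \<le> g i e \<and> g i e \<le> 1) \<and>
     (\<forall>i\<in>{1..<N}. \<forall>k\<in>states T.
        (\<Sum>e | e \<in> edges T \<and> edge_final T e = k. g i e) =
        (\<Sum>e | e \<in> edges T \<and> edge_init T e = k. g (Suc i) e)) \<and>
     (\<forall>i\<in>{1..N}. (\<Sum>e\<in>edges T. g i e) = 1)}"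

text \<open>The matrix \<open>H\<close> has rows \<open>1, ..., m\<close> and columns \<open>1, ..., N\<close>.\<close>

definition row_supports :: "nat \<Rightarrow> nat \<Rightarrow> (nat \<Rightarrow> nat \<Rightarrow> bit) \<Rightarrow> nat set set" where
  "row_supports m N H = (\<lambda>j. {i\<in>{1..N}. H j i = 1}) ` {1..m}"

definition code_polytope :: "nat \<Rightarrow> nat \<Rightarrow> (nat \<Rightarrow> nat \<Rightarrow> bit) \<Rightarrow> (nat \<Rightarrow> real) set" where
  "code_polytope m N H = {f.
     (\<forall>i\<in>{1..N}. 0 \<le> f i \<and> f i \<le> 1) \<and>
     (\<forall>L\<in>row_supports m N H. \<forall>S. S \<subseteq> L \<and> odd (card S) \<longrightarrow>
        (\<Sum>i\<in>S. f i) - (\<Sum>i\<in>L - S. f i) \<le> real (card S) - 1)}"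

definition input_vector :: "'s trellis \<Rightarrow> (nat \<Rightarrow> nat \<Rightarrow> real) \<Rightarrow> nat \<Rightarrow> real" where
  "input_vector T g i = (\<Sum>e | e \<in> edges T \<and> edge_input T e = 1. g i e)"

definition joint_polytope ::
  "'s trellis \<Rightarrow> nat \<Rightarrow> nat \<Rightarrow> (nat \<Rightarrow> nat \<Rightarrow> bit) \<Rightarrow> (nat \<Rightarrow> nat \<Rightarrow> real) set" where
  "joint_polytope T m N H = {g \<in> trellis_polytope T N. input_vector T g \<in> code_polytope m N H}"

definition trellis_integral :: "'s trellis \<Rightarrow> nat \<Rightarrow> (nat \<Rightarrow> nat \<Rightarrow> real) \<Rightarrow> bool" where
  "trellis_integral T N g \<longleftrightarrow> (\<forall>i\<in>{1..N}. \<forall>e\<in>edges T. g i e \<in> {0, 1})"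

definition trellis_codeword ::
  "'s trellis \<Rightarrow> nat \<Rightarrow> nat \<Rightarrow> (nat \<Rightarrow> nat \<Rightarrow> bit) \<Rightarrow> (nat \<Rightarrow> nat \<Rightarrow> real) \<Rightarrow> bool" where
  "trellis_codeword T m N H g \<longleftrightarrow> g \<in> joint_polytope T m N H \<and> trellis_integral T N g"

definition jd_trellis_pseudo_codeword ::
  "'s trellis \<Rightarrow> nat \<Rightarrow> nat \<Rightarrow> (nat \<Rightarrow> nat \<Rightarrow> bit) \<Rightarrow> (nat \<Rightarrow> nat \<Rightarrow> real) \<Rightarrow> bool" where
  "jd_trellis_pseudo_codeword T m N H g \<longleftrightarrow>
     g \<in> joint_polytope T m N H \<and> \<not> trellis_integral T N g"

text \<open>
  Signal-space vectors are extensional (\<^const>\<open>undefined\<close> outside \<open>{1..N}\<close>), so that equality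
  of functions is equality of vectors of length \<open>N\<close>.
\<close>

definition signal_vector ::
  "'s trellis \<Rightarrow> nat \<Rightarrow> (nat \<Rightarrow> nat \<Rightarrow> real) \<Rightarrow> nat \<Rightarrow> real" where
  "signal_vector T N g = (\<lambda>i\<in>{1..N}. \<Sum>e\<in>edges T. g i e * edge_output T e)"

definition SSCW ::
  "'s trellis \<Rightarrow> nat \<Rightarrow> nat \<Rightarrow> (nat \<Rightarrow> nat \<Rightarrow> bit) \<Rightarrow> (nat \<Rightarrow> real) \<Rightarrow> bool" where
  "SSCW T m N H c \<longleftrightarrow> (\<exists>g. trellis_codeword T m N H g \<and> c = signal_vector T N g)"

text \<open>
  \<open>g\<close> is an argument because a signal-space vector may have several trellis-wise descriptions,
  on which both the decoder metric and the generalized distance depend.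
\<close>

definition JD_SSPCW ::
  "'s trellis \<Rightarrow> nat \<Rightarrow> nat \<Rightarrow> (nat \<Rightarrow> nat \<Rightarrow> bit) \<Rightarrow> (nat \<Rightarrow> real) \<Rightarrow>
   (nat \<Rightarrow> nat \<Rightarrow> real) \<Rightarrow> bool" where
  "JD_SSPCW T m N H p g \<longleftrightarrow> jd_trellis_pseudo_codeword T m N H g \<and> p = signal_vector T N g"

definition awgn :: "'w measure \<Rightarrow> nat \<Rightarrow> real \<Rightarrow> (nat \<Rightarrow> 'w \<Rightarrow> real) \<Rightarrow> bool" where
  "awgn M N \<sigma> v \<longleftrightarrow>
     prob_space M \<and>
     prob_space.indep_vars M (\<lambda>_. borel) v {1..N} \<and>
     (\<forall>i\<in>{1..N}. distributed M lborel (v i) (normal_density 0 \<sigma>))"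

definition lp_objective ::
  "'s trellis \<Rightarrow> nat \<Rightarrow> (nat \<Rightarrow> real) \<Rightarrow> (nat \<Rightarrow> nat \<Rightarrow> real) \<Rightarrow> real" where
  "lp_objective T N y g = (\<Sum>i=1..N. \<Sum>e\<in>edges T. g i e * (y i - edge_output T e)^2)"

definition pairwise_error_prob ::
  "'w measure \<Rightarrow> (nat \<Rightarrow> 'w \<Rightarrow> real) \<Rightarrow> 's trellis \<Rightarrow> nat \<Rightarrow> (nat \<Rightarrow> real) \<Rightarrow>
   (nat \<Rightarrow> nat \<Rightarrow> real) \<Rightarrow> real" where
  "pairwise_error_prob M v T N c g =
     measure M {\<omega> \<in> space M.
       let y = (\<lambda>i. c i + v i \<omega>) in lp_objective T N y g \<le> (\<Sum>i=1..N. (y i - c i)^2)}"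

definition dist_sq :: "nat \<Rightarrow> (nat \<Rightarrow> real) \<Rightarrow> (nat \<Rightarrow> real) \<Rightarrow> real" where
  "dist_sq N c p = (\<Sum>i=1..N. (c i - p i)^2)"

definition sigma_p_sq ::
  "'s trellis \<Rightarrow> nat \<Rightarrow> (nat \<Rightarrow> real) \<Rightarrow> (nat \<Rightarrow> nat \<Rightarrow> real) \<Rightarrow> real" where
  "sigma_p_sq T N p g =
     (\<Sum>i=1..N. \<Sum>e\<in>edges T. g i e * (edge_output T e)^2) - (\<Sum>i=1..N. (p i)^2)"

definition d_gen ::
  "'s trellis \<Rightarrow> nat \<Rightarrow> (nat \<Rightarrow> real) \<Rightarrow> (nat \<Rightarrow> real) \<Rightarrow> (nat \<Rightarrow> nat \<Rightarrow> real) \<Rightarrow> real" where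
  "d_gen T N c p g = sqrt ((dist_sq N c p + sigma_p_sq T N p g)^2 / dist_sq N c p)"

definition Q_func :: "real \<Rightarrow> real" where
  "Q_func x = 1 / sqrt (2 * pi) * (LBINT t:{x..}. exp (- (t^2) / 2))"

end

theory Submission
  imports Defs
begin

text \<open>
  Writing \<open>y = c + v\<close> and \<open>d = c - p\<close>, the difference of the two decoder metrics is
  affine in the noise: \<open>2 (d \<bullet> v) + \<parallel>d\<parallel>\<^sup>2 + \<sigma>\<^sub>p\<^sup>2\<close>, because every section of \<open>g\<close> has
  total mass one. As \<open>d \<bullet> v\<close> is a centred Gaussian of standard deviation \<open>\<sigma> \<parallel>d\<parallel>\<close>, the error
  event is a Gaussian tail. Its threshold is nonnegative because \<open>\<sigma>\<^sub>p\<^sup>2\<close> is a sum of variances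
  of the probability vectors \<open>g i\<close>.
\<close>

text \<open>A summand with \<open>a i = 0\<close> is a point mass and has no density, so independent
  Gaussians are added only over the support \<open>J\<close> of \<open>a\<close>, nonempty by
  \<open>nz\<close>. The zero terms are restored afterwards, both in the sum and in the
  variance.\<close>

lemma (in prob_space) linear_combination_indep_normal:
  fixes X :: "'i \<Rightarrow> 'a \<Rightarrow> real" and a :: "'i \<Rightarrow> real"
  assumes fin: "finite I" and indep: "indep_vars (\<lambda>_. borel) X I" and \<sigma>: "0 < \<sigma>"
    and normal: "\<And>i. i \<in> I \<Longrightarrow> distributed M lborel (X i) (normal_density 0 \<sigma>)"
    and nz: "\<exists>i\<in>I. a i \<noteq> 0"
  shows "distributed M lborel (\<lambda>x. \<Sum>i\<in>I. a i * X i x)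
           (normal_density 0 (\<sigma> * sqrt (\<Sum>i\<in>I. (a i)\<^sup>2)))"
proof -
  define J where "J = {i\<in>I. a i \<noteq> 0}"
  have J: "finite J" "J \<noteq> {}" "J \<subseteq> I" "\<And>i. i \<in> J \<Longrightarrow> a i \<noteq> 0"
    using fin nz by (auto simp: J_def)
  have "indep_vars (\<lambda>_. borel) (\<lambda>i x. a i * X i x) J"
    by (rule indep_vars_compose2[OF indep_vars_subset[OF indep J(3)]]) auto
  moreover have "distributed M lborel (\<lambda>x. a i * X i x) (normal_density 0 (\<bar>a i\<bar> * \<sigma>))"
    if "i \<in> J" for i
    using normal_density_affine[OF normal \<sigma> J(4), of i i 0] that J(3) by auto
  ultimately have "distributed M lborel (\<lambda>x. \<Sum>i\<in>J. a i * X i x)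
      (normal_density (\<Sum>i\<in>J. 0) (sqrt (\<Sum>i\<in>J. (\<bar>a i\<bar> * \<sigma>)\<^sup>2)))"
    using J \<sigma> by (intro sum_indep_normal) auto
  moreover have "(\<Sum>i\<in>J. a i * X i x) = (\<Sum>i\<in>I. a i * X i x)" for x
    using fin by (intro sum.mono_neutral_left) (auto simp: J_def)
  moreover have "(\<Sum>i\<in>J. (\<bar>a i\<bar> * \<sigma>)\<^sup>2) = \<sigma>\<^sup>2 * (\<Sum>i\<in>I. (a i)\<^sup>2)"
  proof -
    have "(\<Sum>i\<in>J. (\<bar>a i\<bar> * \<sigma>)\<^sup>2) = (\<Sum>i\<in>I. (\<bar>a i\<bar> * \<sigma>)\<^sup>2)"
      using fin by (intro sum.mono_neutral_left) (auto simp: J_def)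
    then show ?thesis
      by (simp add: power_mult_distrib sum_distrib_left mult.commute)
  qed
  ultimately show ?thesis
    using \<sigma> by (simp add: real_sqrt_mult)
qed

lemma (in prob_space) std_normal_upper_tail:
  assumes "distributed M lborel Z std_normal_density"
  shows "prob {\<omega> \<in> space M. x \<le> Z \<omega>} = Q_func x"
proof -
  have Z: "random_variable lborel Z"
    using assms by (rule distributed_measurable)
  have "prob {\<omega> \<in> space M. x \<le> Z \<omega>} = expectation (indicator {\<omega> \<in> space M. x \<le> Z \<omega>})"
    using Z by simp
  also have "\<dots> = expectation (\<lambda>\<omega>. indicator {x..} (Z \<omega>))"
    by (intro Bochner_Integration.integral_cong) (auto simp: indicator_def)
  also have "\<dots> = (\<integral>t. std_normal_density t * indicator {x..} t \<partial>lborel)"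
    by (intro distributed_integral[OF assms, symmetric]) auto
  also have "\<dots> = (\<integral>t. (1 / sqrt (2 * pi)) * (indicator {x..} t *\<^sub>R exp (- (t\<^sup>2) / 2)) \<partial>lborel)"
    by (intro Bochner_Integration.integral_cong) (auto simp: std_normal_density_def indicator_def)
  also have "\<dots> = Q_func x"
    unfolding Q_func_def set_lebesgue_integral_def by simp
  finally show ?thesis .
qed

text \<open>Multiplication by \<open>- 1 / \<tau>\<close> standardizes and reflects at once, so by
  symmetry the lower tail of \<open>X\<close> becomes an upper tail of a standard normal.\<close>

lemma (in prob_space) normal_lower_tail:
  assumes X: "distributed M lborel X (normal_density 0 \<tau>)" and \<tau>: "0 < \<tau>"
  shows "prob {\<omega> \<in> space M. X \<omega> \<le> - b} = Q_func (b / \<tau>)"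
proof -
  have "distributed M lborel (\<lambda>x. 0 + (- 1 / \<tau>) * X x)
      (normal_density (0 + (- 1 / \<tau>) * 0) (\<bar>- 1 / \<tau>\<bar> * \<tau>))"
    using \<tau> by (intro normal_density_affine[OF X]) auto
  then have "distributed M lborel (\<lambda>x. - X x / \<tau>) std_normal_density"
    using \<tau> by simp
  then have "prob {\<omega> \<in> space M. b / \<tau> \<le> - X \<omega> / \<tau>} = Q_func (b / \<tau>)"
    by (rule std_normal_upper_tail)
  moreover have "b / \<tau> \<le> - X \<omega> / \<tau> \<longleftrightarrow> X \<omega> \<le> - b" for \<omega>
    using divide_le_cancel[of b \<tau> "- X \<omega>"] \<tau> by linarith
  ultimately show ?thesis
    by simp
qed

text \<open>Used with two values of \<open>y\<close>: the received symbol, to expand the decoder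
  metric, and the mean of \<open>a\<close> under \<open>w\<close>, to obtain a variance.\<close>

lemma weighted_square_deviation:
  fixes w a :: "'e \<Rightarrow> real"
  assumes "sum w A = 1"
  shows "(\<Sum>e\<in>A. w e * (y - a e)\<^sup>2) =
    y\<^sup>2 - 2 * y * (\<Sum>e\<in>A. w e * a e) + (\<Sum>e\<in>A. w e * (a e)\<^sup>2)"
proof -
  have "(\<Sum>e\<in>A. w e * (y - a e)\<^sup>2) =
      (\<Sum>e\<in>A. y\<^sup>2 * w e - 2 * y * (w e * a e) + w e * (a e)\<^sup>2)"
    by (intro sum.cong) (auto simp: power2_eq_square algebra_simps)
  also have "\<dots> = y\<^sup>2 * sum w A - 2 * y * (\<Sum>e\<in>A. w e * a e) + (\<Sum>e\<in>A. w e * (a e)\<^sup>2)"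
    by (simp add: sum.distrib sum_subtractf sum_distrib_left)
  finally show ?thesis
    using assms by simp
qed

lemma metric_difference:
  assumes g: "g \<in> trellis_polytope T N" and p: "p = signal_vector T N g"
  shows "lp_objective T N (\<lambda>i. c i + n i) g - (\<Sum>i=1..N. ((c i + n i) - c i)\<^sup>2) =
    2 * (\<Sum>i=1..N. (c i - p i) * n i) + (dist_sq N c p + sigma_p_sq T N p g)"
proof -
  have "(\<Sum>e\<in>edges T. g i e * (y - edge_output T e)\<^sup>2) =
      y\<^sup>2 - 2 * y * p i + (\<Sum>e\<in>edges T. g i e * (edge_output T e)\<^sup>2)"
    if "i \<in> {1..N}" for i y
    using g that by (subst weighted_square_deviation)
      (auto simp: trellis_polytope_def p signal_vector_def)
  then have "lp_objective T N (\<lambda>i. c i + n i) g =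
      (\<Sum>i=1..N. (c i + n i)\<^sup>2 - 2 * (c i + n i) * p i +
        (\<Sum>e\<in>edges T. g i e * (edge_output T e)\<^sup>2))"
    unfolding lp_objective_def by (intro sum.cong) auto
  \<comment> \<open>The squares of \<open>n i\<close> cancel. With all sums merged, section
    \<open>i\<close> leaves \<open>2 * (c i - p i) * n i\<close>, the square of
    \<open>c i - p i\<close>, and the second moment of the output minus the square of
    \<open>p i\<close>.\<close>
  then show ?thesis
    unfolding dist_sq_def sigma_p_sq_def
    by (simp add: sum_distrib_left flip: sum.distrib sum_subtractf)
       (intro sum.cong, auto simp: power2_eq_square algebra_simps)
qed

lemma sigma_p_sq_nonneg:
  assumes g: "g \<in> trellis_polytope T N" and p: "p = signal_vector T N g"
  shows "0 \<le> sigma_p_sq T N p g"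
proof -
  have "0 \<le> (\<Sum>e\<in>edges T. g i e * (edge_output T e)\<^sup>2) - (p i)\<^sup>2" if i: "i \<in> {1..N}" for i
  proof -
    \<comment> \<open>This is the variance of the edge output under the weights \<open>g i\<close>,
      whose mean is \<open>p i\<close>.\<close>
    have "0 \<le> (\<Sum>e\<in>edges T. g i e * (p i - edge_output T e)\<^sup>2)"
      using g i by (intro sum_nonneg) (auto simp: trellis_polytope_def)
    also have "\<dots> = (\<Sum>e\<in>edges T. g i e * (edge_output T e)\<^sup>2) - (p i)\<^sup>2"
      using g i by (subst weighted_square_deviation)
        (auto simp: trellis_polytope_def p signal_vector_def power2_eq_square)
    finally show ?thesis .
  qed
  then show ?thesis
    unfolding sigma_p_sq_def by (subst sum_subtractf[symmetric]) (rule sum_nonneg)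
qed

text \<open>Extensionality turns \<open>p \<noteq> c\<close> into a coordinate in
  \<open>{1..N}\<close> where the two vectors differ.\<close>

lemma signal_vector_eqI:
  assumes "\<And>i. i \<in> {1..N} \<Longrightarrow> signal_vector T N g i = signal_vector T N g' i"
  shows "signal_vector T N g = signal_vector T N g'"
  using assms by (intro extensionalityI[of _ "{1..N}"]) (auto simp: signal_vector_def)

theorem theorem23:
  fixes T :: "'s trellis" and m N :: nat and H :: "nat \<Rightarrow> nat \<Rightarrow> bit"
    and M :: "'w measure" and v :: "nat \<Rightarrow> 'w \<Rightarrow> real" and \<sigma> :: real
    and c p :: "nat \<Rightarrow> real" and g :: "nat \<Rightarrow> nat \<Rightarrow> real"
  assumes "finite_state_trellis T"
    and "\<sigma> > 0"
    and "awgn M N \<sigma> v"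
    and "SSCW T m N H c"
    and "JD_SSPCW T m N H p g"
    and "p \<noteq> c"
  shows "pairwise_error_prob M v T N c g = Q_func (d_gen T N c p g / (2 * \<sigma>))"
proof -
  interpret prob_space M
    using assms(3) by (simp add: awgn_def)
  have g: "g \<in> trellis_polytope T N" and p: "p = signal_vector T N g"
    using assms(5) by (auto simp: JD_SSPCW_def jd_trellis_pseudo_codeword_def joint_polytope_def)
  obtain g' where c: "c = signal_vector T N g'"
    using assms(4) by (auto simp: SSCW_def)
  define D where "D = dist_sq N c p"
  define s where "s = sigma_p_sq T N p g"
  \<comment> \<open>A differing coordinate keeps the projected noise nondegenerate and makes
    division by \<open>sqrt D\<close> legitimate.\<close>
  have nz: "\<exists>i\<in>{1..N}. c i - p i \<noteq> 0"
    using assms(6) signal_vector_eqI[of N T g g'] by (auto simp: c p)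
  then have D: "0 < D"
    unfolding D_def dist_sq_def by (auto intro!: sum_pos2)
  have s: "0 \<le> s"
    unfolding s_def by (rule sigma_p_sq_nonneg[OF g p])
  have "distributed M lborel (\<lambda>\<omega>. \<Sum>i=1..N. (c i - p i) * v i \<omega>)
      (normal_density 0 (\<sigma> * sqrt D))"
    using assms(2,3) nz unfolding D_def dist_sq_def
    by (intro linear_combination_indep_normal) (auto simp: awgn_def)
  \<comment> \<open>The threshold comes from solving "metric difference \<le> 0" for the projected
    noise.\<close>
  then have "prob {\<omega> \<in> space M. (\<Sum>i=1..N. (c i - p i) * v i \<omega>) \<le> - ((D + s) / 2)} =
      Q_func ((D + s) / 2 / (\<sigma> * sqrt D))"
    by (rule normal_lower_tail) (use assms(2) D in simp)
  moreover have "lp_objective T N (\<lambda>i. c i + v i \<omega>) g \<le> (\<Sum>i=1..N. ((c i + v i \<omega>) - c i)\<^sup>2) \<longleftrightarrow>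
      (\<Sum>i=1..N. (c i - p i) * v i \<omega>) \<le> - ((D + s) / 2)" for \<omega>
    using metric_difference[OF g p, of c "\<lambda>i. v i \<omega>"] unfolding D_def s_def by argo
  ultimately have "pairwise_error_prob M v T N c g = Q_func ((D + s) / 2 / (\<sigma> * sqrt D))"
    by (simp add: pairwise_error_prob_def Let_def)
  \<comment> \<open>Since \<open>D + s\<close> is nonnegative, the root of its square is
    \<open>D + s\<close> itself rather than only its absolute value.\<close>
  moreover have "d_gen T N c p g = (D + s) / sqrt D"
    using D s by (simp add: d_gen_def D_def s_def real_sqrt_divide)
  ultimately show ?thesis
    by (simp add: field_simps)
qed

end
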